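(* Let $L:\mathbb{R}^n\to\mathbb{R}^m$ be a linear map, $p\in\mathbb{R}^m$ a point, and let $X:\mathbb{R}^n\to\mathbb{R}^n$ and $Y:\mathbb{R}^m\to\mathbb{R}^m$ be two vector fields such that $$L X(x) = Y(Lx+p)\qquad\text{for all } x\in\mathbb{R}^n.$$ Let $D_X^{(A,b,h,q)}$ and $D_Y^{(A,b,h,q)}$ denote the implicit Runge-Kutta methods with $q$-step iterative solution for $X$ and $Y$ respectively, with the same parameters. Then for any choice of the parameters $A$, $b$, $h$ and $q$ (and any number of stages $s$) and for any $x\in\mathbb{R}^n$, $$L D_X^{(A,b,h,q)}(x) + p = D_Y^{(A,b,h,q)}(Lx+p).$$
   Context: A vector field on $\mathbb{R}^n$ is identified with a map $X:\mathbb{R}^n\to\mathbb{R}^n$. The implicit Runge-Kutta method with $q$-step iterative solution is defined as follows. Choose $s\in\mathbb{N}$, a real matrix $A=(a_{i,j})_{i,j=1}^s$ (arbitrary), real weights $b=(b_i)_{i=1}^s$, a real step size $h$, and a positive integer $q$. For a vector field $X:\mathbb{R}^n\to\mathbb{R}^n$ and a point $x\in\mathbb{R}^n$, define a map $\underline{X}:(\mathbb{R}^n)^s\to(\mathbb{R}^n)^s$ (depending on $x$) by $$\underline{X}(\xi_1,\dots,\xi_s) = \Big(X\big(x+h\sum_{j=1}^s a_{1,j}\xi_j\big),\ \dots,\ X\big(x+h\sum_{j=1}^s a_{s,j}\xi_j\big)\Big).$$ Set $\boldsymbol{\xi}^{(0)} = (X(x),\dots,X(x))\in(\mathbb{R}^n)^s$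 and define recursively $\boldsymbol{\xi}^{(k+1)} := \underline{X}(\boldsymbol{\xi}^{(k)})$ for $k=0,\dots,q-1$. Writing $\boldsymbol{\xi}^{(q)}=(\xi_1^{(q)},\dots,\xi_s^{(q)})$, define $$D_X^{(A,b,h,q)}(x) := x + h\sum_{i=1}^s b_i\,\xi_i^{(q)}.$$ For a vector field $Y:\mathbb{R}^m\to\mathbb{R}^m$ and a point $y\in\mathbb{R}^m$, $D_Y^{(A,b,h,q)}(y)$ is defined in the same way, with $Y$, $m$, $y$ in place of $X$, $n$, $x$ and with the same $s,A,b,h,q$. *)

theory Defs
  imports "HOL-Analysis.Analysis"
begin

text \<open>
  The finite type \<open>'s\<close> indexes the stages, so \<open>(real^'n)^'s\<close> is the space of
  \<open>s\<close>-tuples of vectors in \<open>n\<close>-space. The maps \<open>X\<close> below are arbitrary, with no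
  regularity assumed.
\<close>

definition stage_map ::
  "(real^'n \<Rightarrow> real^'n) \<Rightarrow> real^'s^'s \<Rightarrow> real \<Rightarrow> real^'n \<Rightarrow> (real^'n)^'s \<Rightarrow> (real^'n)^'s"
  where
  "stage_map X A h x \<xi> = (\<chi> i. X (x + h *\<^sub>R (\<Sum>j\<in>UNIV. A $ i $ j *\<^sub>R \<xi> $ j)))"

primrec stage_iter ::
  "(real^'n \<Rightarrow> real^'n) \<Rightarrow> real^'s^'s \<Rightarrow> real \<Rightarrow> real^'n \<Rightarrow> nat \<Rightarrow> (real^'n)^'s"
  where
  "stage_iter X A h x 0 = (\<chi> i. X x)"
| "stage_iter X A h x (Suc k) = stage_map X A h x (stage_iter X A h x k)"

definition rk_iter ::
  "real^'s^'s \<Rightarrow> real^'s \<Rightarrow> real \<Rightarrow> nat \<Rightarrow> (real^'n \<Rightarrow> real^'n) \<Rightarrow> real^'n \<Rightarrow> real^'n"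
  where
  "rk_iter A b h q X x = x + h *\<^sub>R (\<Sum>i\<in>UNIV. b $ i *\<^sub>R stage_iter X A h x q $ i)"

end

theory Submission
  imports Defs
begin

text \<open>
  Every point at which the method evaluates \<open>X\<close> is the base point plus a linear
  combination of stage vectors, and so is the final result. An affine map \<open>z \<mapsto> L z + p\<close>
  carries such a point to the translate of its image base point by the same linear
  combination of the vectors \<open>L \<xi>\<^sub>j\<close>. Since \<open>L \<circ> X\<close> equals \<open>Y\<close> after the affine map,
  \<open>L\<close> sends the initial stages of \<open>X\<close> to those of \<open>Y\<close>, and each further iteration
  preserves this correspondence (\<open>linear_stage_iter\<close>). The final update is again
  such a combination.
\<close>

lemma linear_affine_combination:
  assumes "linear L"
  shows "L (x + h *\<^sub>R (\<Sum>i\<in>I. c i *\<^sub>R v i)) + p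
    = (L x + p) + h *\<^sub>R (\<Sum>i\<in>I. c i *\<^sub>R L (v i))"
  using assms by (simp add: linear_add linear_scale linear_sum)

text \<open>
  The stages are vectors, not points: they transform by the linear part \<open>L\<close> alone, while
  the base point transforms by the full affine map.
\<close>

lemma linear_stage_iter:
  assumes "linear L" and related: "\<And>z. L (X z) = Y (L z + p)"
  shows "L (stage_iter X A h x k $ i) = stage_iter Y A h (L x + p) k $ i"
proof (induction k arbitrary: i)
  case 0
  show ?case by (simp add: related)
next
  case (Suc k)
  then show ?case
    by (simp add: stage_map_def related linear_affine_combination[OF \<open>linear L\<close>])
qed

theorem theorem4p4:
  fixes L :: "real^'n \<Rightarrow> real^'m" and p :: "real^'m"
    and X :: "real^'n \<Rightarrow> real^'n" and Y :: "real^'m \<Rightarrow> real^'m"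
    and A :: "real^'s^'s" and b :: "real^'s" and h :: real and q :: nat
    and x :: "real^'n"
  assumes "linear L"
    and "\<forall>z. L (X z) = Y (L z + p)"
    and "q > 0"
  shows "L (rk_iter A b h q X x) + p = rk_iter A b h q Y (L x + p)"
  using assms(1,2)
  by (simp add: rk_iter_def linear_affine_combination linear_stage_iter[where Y = Y and p = p])

end
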